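(* Suppose that at least one of the following two conditions holds: (cs1) $\lambda^{(n)}>0$ for all $n\in\mathcal{N}$; (cs2) for every (directed) cycle in the Leader-graph, at least one user participating in the cycle has a leader $k$ with positive self-post rate $\lambda^{(k)}>0$. Let $i\in\mathcal{N}$. Then for any initialization vector $\mathbf{p}_i(0)\in\mathbb{R}^N$, the discrete-time linear system $$\mathbf{p}_i(t)=\mathbf{A}\,\mathbf{p}_i(t-1)+\mathbf{b}_i,\qquad t=1,2,\dots,$$ converges, as $t\to\infty$, to the fixed-point solution $\mathbf{p}_i=(\mathbf{I}_N-\mathbf{A})^{-1}\mathbf{b}_i$.
   Context: $\mathcal{N}=\{1,\dots,N\}$ is a finite set of users. Each user $n$ has a nonempty set of leaders $\mathcal{L}^{(n)}\subseteq\mathcal{N}\setminus\{n\}$, a self-post rate $\lambda^{(n)}\ge0$ and a re-post rate $\mu^{(n)}\ge0$, with $\lambda^{(n)}+\mu^{(n)}>0$. The Leader-graph is the directed graph on $\mathcal{N}$ with an edge from $i$ to $j$ exactly when $i\in\mathcal{L}^{(j)}$. $\mathbf{I}_N$ is the $N\times N$ identity matrix. $\mathbf{A}=(a_{j,k})$ is the $N\times N$ matrix and $\mathbf{b}_i=(b_{j,i})_{j=1}^N$ the column vector with entries $$a_{j,k}=\frac{\mu^{(k)}\,\mathbf{1}_{\{k\in\mathcal{L}^{(j)}\}}}{\sum_{\ell\in\mathcal{L}^{(j)}}(\lambda^{(\ell)}+\mu^{(\ell)})},\qquad b_{j,i}=\frac{\lambda^{(i)}\,\mathbf{1}_{\{i\in\mathcal{L}^{(j)}\}}}{\sum_{\ell\in\mathcal{L}^{(j)}}(\lambda^{(\ell)}+\mu^{(\ell)})}.$$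 *)

theory Defs
  imports "HOL-Analysis.Analysis" "Graph_Theory.Arc_Walk"
begin

text \<open>
  The set of users is the universe of a finite type \<open>'n\<close>, so that \<open>N = CARD('n)\<close>.
  The argument \<open>L\<close> maps a user to its set of leaders; \<open>lam\<close> and \<open>mu\<close> are the self-post
  and re-post rates.
\<close>

definition user_model ::
    "('n::finite \<Rightarrow> 'n set) \<Rightarrow> ('n \<Rightarrow> real) \<Rightarrow> ('n \<Rightarrow> real) \<Rightarrow> bool" where
  "user_model L lam mu \<longleftrightarrow>
     (\<forall>n. L n \<noteq> {} \<and> L n \<subseteq> UNIV - {n} \<and> lam n \<ge> 0 \<and> mu n \<ge> 0 \<and> lam n + mu n > 0)"

text \<open>Arcs point from a leader to its follower.\<close>

definition leader_graph :: "('n \<Rightarrow> 'n set) \<Rightarrow> ('n, 'n \<times> 'n) pre_digraph" where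
  "leader_graph L = \<lparr>verts = UNIV, arcs = {(i, j). i \<in> L j}, tail = fst, head = snd\<rparr>"

definition matrix_A ::
    "('n::finite \<Rightarrow> 'n set) \<Rightarrow> ('n \<Rightarrow> real) \<Rightarrow> ('n \<Rightarrow> real) \<Rightarrow> real^'n^'n" where
  "matrix_A L lam mu =
     (\<chi> j k. mu k * indicator (L j) k / (\<Sum>l\<in>L j. lam l + mu l))"

definition vector_b ::
    "('n::finite \<Rightarrow> 'n set) \<Rightarrow> ('n \<Rightarrow> real) \<Rightarrow> ('n \<Rightarrow> real) \<Rightarrow> 'n \<Rightarrow> real^'n" where
  "vector_b L lam mu i =
     (\<chi> j. lam i * indicator (L j) i / (\<Sum>l\<in>L j. lam l + mu l))"

definition cs1 :: "('n \<Rightarrow> real) \<Rightarrow> bool" where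
  "cs1 lam \<longleftrightarrow> (\<forall>n. lam n > 0)"

text \<open>
  A cycle is a list of arcs (closed walk without repeated vertices, of length at least 1;
  loops do not occur in a leader graph of a \<^const>\<open>user_model\<close>).
  Its vertices are exactly the heads of its arcs.
\<close>

definition cs2 :: "('n \<Rightarrow> 'n set) \<Rightarrow> ('n \<Rightarrow> real) \<Rightarrow> bool" where
  "cs2 L lam \<longleftrightarrow>
     (\<forall>c. pre_digraph.cycle (leader_graph L) c \<longrightarrow>
        (\<exists>n \<in> head (leader_graph L) ` set c. \<exists>k \<in> L n. lam k > 0))"

end

theory Submission
  imports Defs "Graph_Theory.Digraph_Component"
begin

text \<open>
  The iterates \<open>A\<^sup>t 1\<close> of the all-ones vector decrease, because \<open>A\<close> is substochastic, to a vector
  \<open>e \<ge> 0\<close> with \<open>A e = e\<close>. If the maximum of \<open>e\<close> were positive, every row of \<open>A\<close> at which it is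
  attained would have sum \<open>1\<close> and be supported on such indices. For a user this says that no leader
  self-posts and that all leaders attain the maximum too; walking backwards along leaders then
  closes a cycle that violates (cs2). Hence \<open>A\<^sup>t 1\<close> tends to \<open>0\<close>, and with it \<open>A\<^sup>t x\<close> for every \<open>x\<close>.
\<close>

section \<open>Cycles inside predecessor-closed vertex sets\<close>

text \<open>If the arcs inside \<open>B\<close> were acyclic, they would be well-founded, and a
  minimal vertex of \<open>B\<close> would contradict \<open>pred\<close>. So there is a closed walk
  inside \<open>B\<close>, which contains a cycle.\<close>

lemma (in wf_digraph) cycle_within_predecessor_closed:
  assumes "finite B" and "B \<noteq> {}" and "B \<subseteq> verts G"
    and pred: "\<And>v. v \<in> B \<Longrightarrow> \<exists>e\<in>arcs G. head G e = v \<and> tail G e \<in> B"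
  shows "\<exists>c. cycle c \<and> head G ` set c \<subseteq> B"
proof -
  define H where
    "H = G\<lparr>verts := B, arcs := {e \<in> arcs G. tail G e \<in> B \<and> head G e \<in> B}\<rparr>"
  interpret H: wf_digraph H
    by unfold_locales (auto simp: H_def)
  have sub: "subgraph H G"
    using assms(3) wf_digraph_axioms H.wf_digraph_axioms
    by (auto simp: subgraph_def compatible_def H_def)
  \<comment> \<open>\<open>G\<close> may have infinitely many arcs; their endpoint pairs inside the
    finite \<open>B\<close> are finitely many, so acyclicity gives well-foundedness.\<close>
  have ends: "arcs_ends H \<subseteq> B \<times> B"
    by (auto simp: arcs_ends_def arc_to_ends_def H_def)
  have "\<not> acyclic (arcs_ends H)"
  proof
    assume "acyclic (arcs_ends H)"
    moreover have "finite (arcs_ends H)"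
      using ends assms(1) by (meson finite_SigmaI finite_subset)
    ultimately have "wf (arcs_ends H)"
      by (rule finite_acyclic_wf[rotated])
    then obtain v where v: "v \<in> B" and min: "\<And>u. (u, v) \<in> arcs_ends H \<Longrightarrow> u \<notin> B"
      using assms(2) wfE_min[where Q = B] by blast
    obtain e where "e \<in> arcs G" "head G e = v" "tail G e \<in> B"
      using pred[OF v] by blast
    then have "(tail G e, v) \<in> arcs_ends H"
      using v by (auto simp: arcs_ends_def arc_to_ends_def H_def)
    with min \<open>tail G e \<in> B\<close> show False by blast
  qed
  then obtain u where "u \<rightarrow>\<^sup>+\<^bsub>H\<^esub> u"
    by (auto simp: acyclic_def)
  then obtain p where "H.closed_w p"
    by (auto simp: H.reachable1_awalk H.closed_w_def)
  then obtain c where c: "H.cycle c"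
    using H.closed_w_imp_cycle by blast
  then have "set c \<subseteq> arcs H"
    by (auto simp: H.cycle_def H.awalk_def)
  then have "head G ` set c \<subseteq> B"
    by (auto simp: H_def)
  with subgraph_cycle[OF sub c] show ?thesis by blast
qed

section \<open>Powers of substochastic matrices\<close>

lemma matrix_vector_mult_mono:
  fixes A :: "real^'n^'m"
  assumes "\<And>j k. 0 \<le> A $ j $ k" and "\<And>k. x $ k \<le> y $ k"
  shows "(A *v x) $ j \<le> (A *v y) $ j"
  by (auto simp: matrix_vector_mult_def intro!: sum_mono mult_left_mono assms)

lemma abs_matrix_vector_mult_le:
  fixes A :: "real^'n^'m"
  assumes "\<And>j k. 0 \<le> A $ j $ k" and "\<And>k. \<bar>x $ k\<bar> \<le> y $ k"
  shows "\<bar>(A *v x) $ j\<bar> \<le> (A *v y) $ j"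
proof -
  have "\<bar>(A *v x) $ j\<bar> \<le> (\<Sum>k\<in>UNIV. \<bar>A $ j $ k * x $ k\<bar>)"
    unfolding matrix_vector_mult_def by simp
  also have "\<dots> \<le> (\<Sum>k\<in>UNIV. A $ j $ k * y $ k)"
    by (auto simp: abs_mult assms(1) intro!: sum_mono mult_left_mono assms)
  finally show ?thesis
    by (simp add: matrix_vector_mult_def)
qed

text \<open>\<open>no_class\<close> says that no nonempty \<open>B\<close> is a closed class on
  which \<open>A\<close> is stochastic. The indices at which a positive limit of the iterates is
  maximal would form such a class.\<close>

lemma substochastic_powers_tendsto_0:
  fixes A :: "real^'n^'n"
  assumes nonneg: "\<And>j k. 0 \<le> A $ j $ k"
    and substoch: "\<And>j. (\<Sum>k\<in>UNIV. A $ j $ k) \<le> 1"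
    and no_class: "\<And>B. B \<noteq> {} \<Longrightarrow>
      \<exists>j\<in>B. (\<Sum>k\<in>UNIV. A $ j $ k) \<noteq> 1 \<or> (\<exists>k. A $ j $ k > 0 \<and> k \<notin> B)"
  shows "(\<lambda>t. (((*v) A) ^^ t) x) \<longlonglongrightarrow> 0"
proof -
  define w :: "nat \<Rightarrow> real^'n" where "w t = (((*v) A) ^^ t) (\<chi> _. 1)" for t
  have w0: "w 0 $ j = 1" and wSuc: "w (Suc t) = A *v w t" for j t
    by (simp_all add: w_def)
  have w_nonneg: "0 \<le> w t $ j" for t j
  proof (induction t arbitrary: j)
    case (Suc t)
    then show ?case
      by (simp add: wSuc matrix_vector_mult_def nonneg sum_nonneg)
  qed (simp add: w0)
  have w_step: "w (Suc t) $ j \<le> w t $ j" for t j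
  proof (induction t arbitrary: j)
    case 0
    then show ?case
      using substoch by (simp add: wSuc matrix_vector_mult_def w0)
  next
    case (Suc t)
    then show ?case
      by (subst (1 2) wSuc) (intro matrix_vector_mult_mono nonneg)
  qed
  have "convergent (\<lambda>t. w t $ j)" for j
    by (rule Bseq_monoseq_convergent[OF decseq_bounded[of _ 0] decseq_imp_monoseq])
      (auto simp: decseq_Suc_iff w_step w_nonneg)
  then obtain e where e: "\<And>j. (\<lambda>t. w t $ j) \<longlonglongrightarrow> e j"
    unfolding convergent_def by metis
  have e_nonneg: "0 \<le> e j" for j
    by (rule LIMSEQ_le_const[OF e]) (auto simp: w_nonneg)
  have e_fix: "e j = (\<Sum>k\<in>UNIV. A $ j $ k * e k)" for j
  proof (rule LIMSEQ_unique)
    show "(\<lambda>t. w (Suc t) $ j) \<longlonglongrightarrow> e j"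
      using e by (rule LIMSEQ_Suc)
    show "(\<lambda>t. w (Suc t) $ j) \<longlonglongrightarrow> (\<Sum>k\<in>UNIV. A $ j $ k * e k)"
      unfolding wSuc matrix_vector_mult_def by (auto intro!: tendsto_intros e)
  qed
  define M where "M = Max (range e)"
  have le_M: "e j \<le> M" for j
    by (simp add: M_def)
  have "M \<le> 0"
  proof (rule ccontr)
    assume "\<not> M \<le> 0"
    then have M: "M > 0" by simp
    have "M \<in> range e"
      unfolding M_def by (rule Max_in) auto
    then have "{j. e j = M} \<noteq> {}" by blast
    from no_class[OF this] obtain j where j: "e j = M"
      and *: "(\<Sum>k\<in>UNIV. A $ j $ k) \<noteq> 1 \<or> (\<exists>k. A $ j $ k > 0 \<and> e k \<noteq> M)"
      by blast
    \<comment> \<open>Row \<open>j\<close> of the fixed-point equation, split into the defect of the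
      row sum and the weighted gaps \<open>M - e k\<close>. Both parts are nonnegative, so both
      vanish.\<close>
    have "M * (1 - (\<Sum>k\<in>UNIV. A $ j $ k)) + (\<Sum>k\<in>UNIV. A $ j $ k * (M - e k)) = 0"
      using e_fix[of j] j by (simp add: right_diff_distrib sum_subtractf flip: sum_distrib_right)
    moreover have "0 \<le> M * (1 - (\<Sum>k\<in>UNIV. A $ j $ k))"
      using M substoch by simp
    moreover have terms: "0 \<le> A $ j $ k * (M - e k)" for k
      using nonneg le_M by simp
    moreover have "0 \<le> (\<Sum>k\<in>UNIV. A $ j $ k * (M - e k))"
      using terms by (simp add: sum_nonneg)
    ultimately have "M * (1 - (\<Sum>k\<in>UNIV. A $ j $ k)) = 0"
      and "(\<Sum>k\<in>UNIV. A $ j $ k * (M - e k)) = 0"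
      by linarith+
    then have "(\<Sum>k\<in>UNIV. A $ j $ k) = 1" and "\<forall>k. A $ j $ k * (M - e k) = 0"
      using M terms by (auto simp: sum_nonneg_eq_0_iff)
    with * show False by (metis diff_gt_0_iff_gt less_irrefl mult_eq_0_iff eq_iff_diff_eq_0)
  qed
  then have "e j = 0" for j
    using le_M[of j] e_nonneg[of j] by linarith
  then have w_lim: "(\<lambda>t. w t $ j) \<longlonglongrightarrow> 0" for j
    using e by metis
  \<comment> \<open>Every entry of \<open>x\<close> is at most \<open>norm x\<close> in absolute
    value, so the orbit of \<open>x\<close> is dominated by \<open>norm x\<close> times that of the
    all-ones vector.\<close>
  have bound: "\<bar>((((*v) A) ^^ t) x) $ j\<bar> \<le> norm x * w t $ j" for t j
  proof (induction t arbitrary: j)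
    case 0
    then show ?case by (simp add: w0 component_le_norm_cart)
  next
    case (Suc t)
    then have "\<bar>(A *v (((*v) A) ^^ t) x) $ j\<bar> \<le> (A *v (norm x *\<^sub>R w t)) $ j"
      by (intro abs_matrix_vector_mult_le nonneg) simp
    then show ?case
      by (simp add: wSuc matrix_vector_mult_scaleR)
  qed
  show ?thesis
  proof (rule vec_tendstoI)
    fix j
    show "(\<lambda>t. ((((*v) A) ^^ t) x) $ j) \<longlonglongrightarrow> 0 $ j"
      unfolding zero_index
      by (rule Lim_null_comparison[OF always_eventually tendsto_mult_right_zero[OF w_lim[of j], of "norm x"]])
        (use bound in simp)
  qed
qed

section \<open>Affine iterations and their fixed point\<close>

text \<open>A vector in the kernel of \<open>mat 1 - A\<close> is fixed by \<open>A\<close>; its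
  constant orbit tends to \<open>0\<close> only if the vector is \<open>0\<close>.\<close>

lemma invertible_if_powers_tendsto_0:
  fixes A :: "real^'n^'n"
  assumes "\<And>x. (\<lambda>t. (((*v) A) ^^ t) x) \<longlonglongrightarrow> 0"
  shows "invertible (mat 1 - A)"
  unfolding invertible_left_inverse matrix_left_invertible_ker
proof (intro allI impI)
  fix x
  assume "(mat 1 - A) *v x = 0"
  then have fixed: "A *v x = x"
    by (simp add: matrix_vector_mult_diff_rdistrib)
  have "(((*v) A) ^^ t) x = x" for t
    by (induction t) (simp_all add: fixed)
  with assms[of x] show "x = 0"
    by (simp add: LIMSEQ_const_iff)
qed

text \<open>Subtracting the fixed-point equation cancels \<open>b\<close>, so the error at time
  \<open>t\<close> is the \<open>t\<close>-th power of \<open>A\<close> applied to the initial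
  error.\<close>

lemma affine_iteration_tendsto:
  fixes A :: "real^'n^'n"
  assumes lim: "\<And>x. (\<lambda>t. (((*v) A) ^^ t) x) \<longlonglongrightarrow> 0"
    and step: "\<And>t. p (Suc t) = A *v p t + b"
  shows "p \<longlonglongrightarrow> matrix_inv (mat 1 - A) *v b"
proof -
  define q where "q = matrix_inv (mat 1 - A) *v b"
  have "(mat 1 - A) ** matrix_inv (mat 1 - A) = mat 1"
    using invertible_if_powers_tendsto_0[OF lim]
    unfolding invertible_def matrix_inv_def by (rule someI2_ex) blast
  then have "(mat 1 - A) *v q = b"
    by (simp add: q_def matrix_vector_mul_assoc)
  then have q: "q = A *v q + b"
    by (simp add: matrix_vector_mult_diff_rdistrib algebra_simps)
  have "p t - q = (((*v) A) ^^ t) (p 0 - q)" for t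
  proof (induction t)
    case (Suc t)
    \<comment> \<open>The equation \<open>q\<close> is applied to the single \<open>q\<close> on the
      left; as a rewrite rule it would loop.\<close>
    have "p (Suc t) - q = A *v p t + b - (A *v q + b)"
      unfolding step by (rule arg_cong[OF q])
    also have "\<dots> = A *v (p t - q)"
      by (simp add: matrix_vector_mult_diff_distrib)
    finally show ?case
      by (simp add: Suc)
  qed simp
  then have "(\<lambda>t. p t - q) = (\<lambda>t. (((*v) A) ^^ t) (p 0 - q))"
    by (rule ext)
  then have "(\<lambda>t. p t - q) \<longlonglongrightarrow> 0"
    by (rule ssubst) (rule lim)
  then show ?thesis
    by (simp add: q_def LIM_zero_iff)
qed

section \<open>The leader graph and its matrix\<close>

text \<open>A cycle has an arc, and the head of that arc has some leader. This reduces the theorem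
  to the case \<open>cs2\<close>.\<close>

lemma cs1_imp_cs2:
  assumes "\<And>n. L n \<noteq> {}" and "cs1 lam"
  shows "cs2 L lam"
  unfolding cs2_def
proof (intro allI impI)
  fix c
  assume "pre_digraph.cycle (leader_graph L) c"
  then have "c \<noteq> []"
    by (auto simp: pre_digraph.cycle_def)
  then obtain a where "a \<in> set c"
    using last_in_set by blast
  with assms show "\<exists>n\<in>head (leader_graph L) ` set c. \<exists>k\<in>L n. lam k > 0"
    unfolding cs1_def by blast
qed

text \<open>Arcs run from leader to follower, so a leader inside \<open>B\<close> is a predecessor
  inside \<open>B\<close>. The resulting cycle stays in \<open>B\<close>, where \<open>cs2\<close>
  applies to it.\<close>

lemma cs2_predecessor_closed:
  assumes "cs2 L lam" and "finite B" and "B \<noteq> {}" and "\<And>n. n \<in> B \<Longrightarrow> L n \<inter> B \<noteq> {}"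
  shows "\<exists>n\<in>B. \<exists>k\<in>L n. lam k > 0"
proof -
  interpret wf_digraph "leader_graph L"
    by unfold_locales (auto simp: leader_graph_def)
  have "\<exists>e\<in>arcs (leader_graph L). head (leader_graph L) e = n \<and> tail (leader_graph L) e \<in> B"
    if "n \<in> B" for n
    using assms(4)[OF that] by (auto simp: leader_graph_def)
  then obtain c where "cycle c" "head (leader_graph L) ` set c \<subseteq> B"
    using cycle_within_predecessor_closed[OF assms(2,3)] by (auto simp: leader_graph_def)
  with assms(1) show ?thesis
    unfolding cs2_def by blast
qed

lemma sum_leader_rates_pos:
  assumes "user_model L lam mu"
  shows "(\<Sum>l\<in>L j. lam l + mu l) > 0"
  using assms by (intro sum_pos) (auto simp: user_model_def)

lemma matrix_A_nonneg:
  assumes "user_model L lam mu"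
  shows "0 \<le> matrix_A L lam mu $ j $ k"
  using assms sum_leader_rates_pos[OF assms, of j]
  by (auto simp: matrix_A_def user_model_def)

lemma matrix_A_pos_iff:
  assumes "user_model L lam mu"
  shows "0 < matrix_A L lam mu $ j $ k \<longleftrightarrow> k \<in> L j \<and> mu k > 0"
  using sum_leader_rates_pos[OF assms, of j]
  by (auto simp: matrix_A_def indicator_def zero_less_divide_iff)

text \<open>The defect is the share of self-posts in the total rate of the leaders of
  \<open>j\<close>. As rates are nonnegative, it vanishes exactly when no leader of \<open>j\<close>
  self-posts.\<close>

lemma row_sum_matrix_A:
  assumes "user_model L lam mu"
  shows "(\<Sum>k\<in>UNIV. matrix_A L lam mu $ j $ k) =
    1 - (\<Sum>l\<in>L j. lam l) / (\<Sum>l\<in>L j. lam l + mu l)"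
proof -
  have "(\<Sum>k\<in>UNIV. matrix_A L lam mu $ j $ k) =
      (\<Sum>k\<in>UNIV. mu k * indicator (L j) k) / (\<Sum>l\<in>L j. lam l + mu l)"
    by (simp add: matrix_A_def flip: sum_divide_distrib)
  also have "(\<Sum>k\<in>UNIV. mu k * indicator (L j) k) = (\<Sum>k\<in>L j. mu k)"
    by (simp add: indicator_def if_distrib sum.If_cases cong: if_cong)
  finally show ?thesis
    using sum_leader_rates_pos[OF assms, of j] by (simp add: field_simps sum.distrib)
qed

lemma matrix_A_powers_tendsto_0:
  assumes model: "user_model L lam mu" and "cs2 L lam"
  shows "(\<lambda>t. (((*v) (matrix_A L lam mu)) ^^ t) x) \<longlonglongrightarrow> 0"
proof (rule substochastic_powers_tendsto_0)
  note pos = sum_leader_rates_pos[OF model]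
  have lam_nonneg: "lam n \<ge> 0" and L_ne: "L n \<noteq> {}" and rate_pos: "lam n + mu n > 0" for n
    using model by (auto simp: user_model_def)
  show "0 \<le> matrix_A L lam mu $ j $ k" for j k
    using model by (rule matrix_A_nonneg)
  show "(\<Sum>k\<in>UNIV. matrix_A L lam mu $ j $ k) \<le> 1" for j
    using pos[of j] by (simp add: row_sum_matrix_A[OF model] lam_nonneg sum_nonneg)
  fix B :: "'a set"
  assume "B \<noteq> {}"
  show "\<exists>j\<in>B. (\<Sum>k\<in>UNIV. matrix_A L lam mu $ j $ k) \<noteq> 1 \<or>
      (\<exists>k. matrix_A L lam mu $ j $ k > 0 \<and> k \<notin> B)"
  proof (rule ccontr)
    assume "\<not> ?thesis"
    then have sum1: "(\<Sum>k\<in>UNIV. matrix_A L lam mu $ j $ k) = 1"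
      and closed: "matrix_A L lam mu $ j $ k > 0 \<Longrightarrow> k \<in> B" if "j \<in> B" for j k
      using that by blast+
    have lam0: "lam k = 0" if "j \<in> B" "k \<in> L j" for j k
    proof -
      have "(\<Sum>l\<in>L j. lam l) = 0"
        using sum1[OF that(1)] pos[of j] by (simp add: row_sum_matrix_A[OF model])
      then show ?thesis
        using that(2) lam_nonneg by (simp add: sum_nonneg_eq_0_iff)
    qed
    \<comment> \<open>A leader with \<open>lam k = 0\<close> has \<open>mu k > 0\<close>, hence a
      positive entry in row \<open>j\<close>, and closedness of \<open>B\<close> captures
      it.\<close>
    have "L j \<subseteq> B" if "j \<in> B" for j
      using closed[OF that] lam0[OF that] rate_pos
      by (metis add_0 matrix_A_pos_iff[OF model] subsetI)
    then have "L j \<inter> B \<noteq> {}" if "j \<in> B" for j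
      using that L_ne by blast
    then obtain n k where "n \<in> B" "k \<in> L n" "lam k > 0"
      using cs2_predecessor_closed[OF assms(2) _ \<open>B \<noteq> {}\<close>] by auto
    with lam0 show False by force
  qed
qed

text \<open>\<open>matrix_inv\<close> is defined by choice; the first conjunct ensures that it
  denotes the true inverse in the limit.\<close>

theorem theorem4:
  fixes L :: "'n::finite \<Rightarrow> 'n set"
    and lam mu :: "'n \<Rightarrow> real"
    and i :: 'n
  assumes "user_model L lam mu"
    and "cs1 lam \<or> cs2 L lam"
  shows "invertible (mat 1 - matrix_A L lam mu) \<and>
    (\<forall>p :: nat \<Rightarrow> real^'n.
       (\<forall>t\<ge>1. p t = matrix_A L lam mu *v p (t - 1) + vector_b L lam mu i) \<longrightarrow>
       p \<longlonglongrightarrow> matrix_inv (mat 1 - matrix_A L lam mu) *v vector_b L lam mu i)"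
proof -
  have "cs2 L lam"
    using assms cs1_imp_cs2[of L lam] by (auto simp: user_model_def)
  note lim = matrix_A_powers_tendsto_0[OF assms(1) this]
  show ?thesis
  proof (intro conjI allI impI)
    show "invertible (mat 1 - matrix_A L lam mu)"
      by (rule invertible_if_powers_tendsto_0[OF lim])
    fix p :: "nat \<Rightarrow> real^'n"
    assume "\<forall>t\<ge>1. p t = matrix_A L lam mu *v p (t - 1) + vector_b L lam mu i"
    then have "p (Suc t) = matrix_A L lam mu *v p t + vector_b L lam mu i" for t
      by force
    then show "p \<longlonglongrightarrow> matrix_inv (mat 1 - matrix_A L lam mu) *v vector_b L lam mu i"
      by (rule affine_iteration_tendsto[OF lim])
  qed
qed

end
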